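(* Every subdirect product $R$ of artinian $*$-regular rings (with unit) has a unit-regular and $*$-clean extension within its variety; that is, there is a $*$-regular ring $\hat R$ which belongs to the variety of $*$-regular rings generated by $R$, contains $R$ as a $*$-subring (with the same unit), and is both unit-regular and $*$-clean.
   Context: All rings are associative with unit, and the unit $1$ is included into the signature (subrings contain it, homomorphisms preserve it). A $*$-ring is a ring with an involution $a\mapsto a^*$, i.e. $(a+b)^*=a^*+b^*$, $(ab)^*=b^*a^*$, $(a^* )^*=a$. A projection is an element $e$ with $e=e^2=e^*$; projections are ordered by $e\le f \Leftrightarrow fe=e$. A $*$-regular ring is a $*$-ring $R$ that is proper ($aa^*=0$ implies $a=0$) and von Neumann regular (for each $a$ there is $x$ with $axa=a$). In a $*$-regular ring every $a$ has a unique pseudo-inverse $a^+$ with $a=aa^+a$, $a^+=a^+aa^+$, $(aa^+)^*=aa^+$, $(a^+a)^*=a^+a$. With $a\mapsto a^+$ included into the signature, $*$-regular rings form a variety (equational class); varieties of $*$-regular rings, and the variety generated by $R$, are understood in this signature. A $*$-regular ring is artinian if there is a finite bound on the length of chains of projections (equivalently, the ring is right, or left, artinian). A $*$-ring $R$ is unit-regular if for every $a\in R$ there is an invertible $u\in R$ with $aua=a$. It is $*$-clean if for every $a\in R$ there are an invertible $u\in R$ and a projection $e\in R$ with $a=u+e$. $R$ is a subdirect product of artinian $*$-regular rings if $R$ is a $*$-regular ring having a family of two-sided ideals $I_k$ $(k\in K)$ with $\bigcap_{k\in K}I_k=0$ and each $R/I_k$ artinian (all ideals of a $*$-regular ring are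 closed under $*$, and the quotients are $*$-regular). *)

theory Defs
  imports "HOL-Algebra.QuotRing"
begin

section \<open>Rings with involution\<close>

record 'a star_ring = "'a ring" +
  star :: "'a \<Rightarrow> 'a"

locale star_ring = ring R for R :: "('a, 'm) star_ring_scheme" (structure) +
  assumes star_closed: "a \<in> carrier R \<Longrightarrow> star R a \<in> carrier R"
    and star_add: "\<lbrakk>a \<in> carrier R; b \<in> carrier R\<rbrakk> \<Longrightarrow> star R (a \<oplus> b) = star R a \<oplus> star R b"
    and star_mult: "\<lbrakk>a \<in> carrier R; b \<in> carrier R\<rbrakk> \<Longrightarrow> star R (a \<otimes> b) = star R b \<otimes> star R a"
    and star_star: "a \<in> carrier R \<Longrightarrow> star R (star R a) = a"

locale star_regular_ring = star_ring +
  assumes proper: "\<lbrakk>a \<in> carrier R; a \<otimes> star R a = \<zero>\<rbrakk> \<Longrightarrow> a = \<zero>"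
    and regular: "a \<in> carrier R \<Longrightarrow> \<exists>x\<in>carrier R. a \<otimes> x \<otimes> a = a"

definition star_ring_hom ::
    "[('a, 'm) star_ring_scheme, ('b, 'n) star_ring_scheme] \<Rightarrow> ('a \<Rightarrow> 'b) set" where
  "star_ring_hom R S =
    {h \<in> ring_hom R S. \<forall>a\<in>carrier R. h (star R a) = star S (h a)}"

definition projections :: "('a, 'm) star_ring_scheme \<Rightarrow> 'a set" where
  "projections R = {e \<in> carrier R. e \<otimes>\<^bsub>R\<^esub> e = e \<and> star R e = e}"

definition proj_le :: "('a, 'm) star_ring_scheme \<Rightarrow> 'a \<Rightarrow> 'a \<Rightarrow> bool" where
  "proj_le R e f \<longleftrightarrow> f \<otimes>\<^bsub>R\<^esub> e = e"

definition proj_chain :: "('a, 'm) star_ring_scheme \<Rightarrow> 'a set \<Rightarrow> bool" where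
  "proj_chain R C \<longleftrightarrow>
    C \<subseteq> projections R \<and> (\<forall>e\<in>C. \<forall>f\<in>C. proj_le R e f \<or> proj_le R f e)"

text \<open>This is the right notion of artinian for star-regular rings only, where it agrees
  with being right (equivalently, left) artinian.\<close>

definition artinian :: "('a, 'm) star_ring_scheme \<Rightarrow> bool" where
  "artinian R \<longleftrightarrow> (\<exists>n::nat. \<forall>C. proj_chain R C \<longrightarrow> finite C \<and> card C \<le> n)"

definition unit_regular :: "('a, 'm) star_ring_scheme \<Rightarrow> bool" where
  "unit_regular R \<longleftrightarrow> (\<forall>a\<in>carrier R. \<exists>u\<in>Units R. a \<otimes>\<^bsub>R\<^esub> u \<otimes>\<^bsub>R\<^esub> a = a)"

definition star_clean :: "('a, 'm) star_ring_scheme \<Rightarrow> bool" where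
  "star_clean R \<longleftrightarrow> (\<forall>a\<in>carrier R. \<exists>u\<in>Units R. \<exists>e\<in>projections R. a = u \<oplus>\<^bsub>R\<^esub> e)"


section \<open>Quotients and subdirect products\<close>

text \<open>\<open>R Quot I\<close> drops the record extension, so the involution is put back, acting on cosets
  elementwise: \<open>star (I + a) = I + star a\<close> whenever \<open>I\<close> is closed under \<open>star\<close>, as all ideals
  of a star-regular ring are.\<close>

definition star_quot :: "[('a, 'm) star_ring_scheme, 'a set] \<Rightarrow> 'a set star_ring" where
  "star_quot R I =
    \<lparr>carrier = carrier (R Quot I), mult = mult (R Quot I), one = one (R Quot I),
     zero = zero (R Quot I), add = add (R Quot I), star = (\<lambda>X. star R ` X)\<rparr>"

text \<open>Intersecting with \<open>carrier R\<close> matters only for \<open>K = {}\<close>. The quotients of a star-regular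
  ring are again star-regular, so this is not demanded separately.\<close>

definition subdirect_product_of_artinian ::
    "[('a, 'm) star_ring_scheme, 'k set, 'k \<Rightarrow> 'a set] \<Rightarrow> bool" where
  "subdirect_product_of_artinian R K I \<longleftrightarrow>
    star_regular_ring R \<and>
    (\<forall>k\<in>K. ideal (I k) R) \<and>
    carrier R \<inter> (\<Inter>k\<in>K. I k) = {\<zero>\<^bsub>R\<^esub>} \<and>
    (\<forall>k\<in>K. artinian (star_quot R (I k)))"


section \<open>Varieties of star-regular rings\<close>

definition is_pinv :: "('a, 'm) star_ring_scheme \<Rightarrow> 'a \<Rightarrow> 'a \<Rightarrow> bool" where
  "is_pinv R a x \<longleftrightarrow> x \<in> carrier R \<and>
    a = a \<otimes>\<^bsub>R\<^esub> x \<otimes>\<^bsub>R\<^esub> a \<and> x = x \<otimes>\<^bsub>R\<^esub> a \<otimes>\<^bsub>R\<^esub> x \<and>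
    star R (a \<otimes>\<^bsub>R\<^esub> x) = a \<otimes>\<^bsub>R\<^esub> x \<and> star R (x \<otimes>\<^bsub>R\<^esub> a) = x \<otimes>\<^bsub>R\<^esub> a"

definition pinv :: "('a, 'm) star_ring_scheme \<Rightarrow> 'a \<Rightarrow> 'a" where
  "pinv R a = (THE x. is_pinv R a x)"

text \<open>Terms over countably many variables; equations are finitary, so these suffice.\<close>

datatype sr_term =
    Var nat
  | Zero
  | One
  | Add sr_term sr_term
  | Neg sr_term
  | Mult sr_term sr_term
  | Star sr_term
  | Pinv sr_term

primrec sr_eval :: "('a, 'm) star_ring_scheme \<Rightarrow> (nat \<Rightarrow> 'a) \<Rightarrow> sr_term \<Rightarrow> 'a" where
  "sr_eval R \<rho> (Var i) = \<rho> i"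
| "sr_eval R \<rho> Zero = \<zero>\<^bsub>R\<^esub>"
| "sr_eval R \<rho> One = \<one>\<^bsub>R\<^esub>"
| "sr_eval R \<rho> (Add s t) = sr_eval R \<rho> s \<oplus>\<^bsub>R\<^esub> sr_eval R \<rho> t"
| "sr_eval R \<rho> (Neg t) = \<ominus>\<^bsub>R\<^esub> sr_eval R \<rho> t"
| "sr_eval R \<rho> (Mult s t) = sr_eval R \<rho> s \<otimes>\<^bsub>R\<^esub> sr_eval R \<rho> t"
| "sr_eval R \<rho> (Star t) = star R (sr_eval R \<rho> t)"
| "sr_eval R \<rho> (Pinv t) = pinv R (sr_eval R \<rho> t)"

definition models :: "('a, 'm) star_ring_scheme \<Rightarrow> (sr_term \<times> sr_term) set \<Rightarrow> bool" where
  "models R E \<longleftrightarrow>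
    (\<forall>(s, t)\<in>E. \<forall>\<rho>. range \<rho> \<subseteq> carrier R \<longrightarrow> sr_eval R \<rho> s = sr_eval R \<rho> t)"

text \<open>A variety of star-regular rings is the class of star-regular models of a set \<open>E\<close> of
  equations. The variety generated by \<open>R\<close> is the smallest one containing \<open>R\<close>, so \<open>S\<close> belongs
  to it iff \<open>S\<close> belongs to every variety containing \<open>R\<close>.\<close>

definition in_variety ::
    "[('a, 'm) star_ring_scheme, (sr_term \<times> sr_term) set] \<Rightarrow> bool" where
  "in_variety R E \<longleftrightarrow> star_regular_ring R \<and> models R E"

definition in_variety_generated_by ::
    "[('b, 'n) star_ring_scheme, ('a, 'm) star_ring_scheme] \<Rightarrow> bool" where
  "in_variety_generated_by S R \<longleftrightarrow> (\<forall>E. in_variety R E \<longrightarrow> in_variety S E)"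

end

theory Submission
  imports Defs
begin

text \<open>
  The extension is the full direct product \<open>\<Prod>\<^sub>k R / I\<^sub>k\<close>, into which \<open>R\<close> embeds because
  the ideals intersect in zero. A homomorphic image of a star-regular ring and a product of
  star-regular rings are star-regular, and since pseudo-inverses are characterised by equations,
  every homomorphism preserves them; so each equation of \<open>R\<close> passes to the \<open>R / I\<^sub>k\<close> and
  then to their product. Unit-regularity and star-cleanness are statements about finding some
  elements, hence can be checked componentwise. It remains to prove that a single artinian
  star-regular ring is unit-regular and star-clean.

  For star-cleanness (\<open>artinian_star_clean\<close>), let \<open>p\<close> be a maximal projection whose
  corner \<open>pRp\<close> is star-clean. If \<open>p \<noteq> 1\<close>, there is a minimal nonzero projection
  \<open>e \<le> 1 - p\<close>. Its corner \<open>eRe\<close> is a division ring, and therefore star-clean: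
  \<open>0 = - e + e\<close>, and every other element is a unit plus zero. Star-cleanness of two
  orthogonal corners passes to the corner of their sum (\<open>clean_corner_sum\<close>): clean the first
  diagonal block as \<open>u + g\<close>, and clean the Schur complement of \<open>u\<close> in the other one. So
  \<open>p + e\<close> contradicts the choice of \<open>p\<close>.

  For unit-regularity (\<open>artinian_unit_regular\<close>), extend \<open>a\<close>, viewed as an isomorphism between
  the right ideals of its two support projections, to some \<open>b\<close> with maximal left support. With
  \<open>e\<close> and \<open>f\<close> the complements of the two supports of \<open>b\<close>, maximality forces
  \<open>eRf = 0 = fRe\<close>. Then every \<open>b\<^sup>n e\<close> lies where \<open>b\<close> is injective, while
  \<open>eb = 0\<close>; as the powers of \<open>b\<close> stabilise, this gives \<open>e = 0\<close>
  (\<open>artinian_complement_zero\<close>), and likewise \<open>f = 0\<close>. So \<open>b\<close> is a unit, and its inverse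
  is the required inner inverse of \<open>a\<close>.
\<close>

section \<open>Projections and pseudo-inverses in rings with involution\<close>

context star_ring
begin

declare star_closed [simp]

lemma star_zero: "star R \<zero> = \<zero>"
proof -
  have "star R \<zero> \<oplus> star R \<zero> = star R \<zero> \<oplus> \<zero>"
    using star_add[of \<zero> \<zero>] by simp
  then show ?thesis
    using add.l_cancel_one' by force
qed

lemma star_one: "star R \<one> = \<one>"
  by (metis l_one one_closed r_one star_closed star_mult star_star)

lemma star_minus: "a \<in> carrier R \<Longrightarrow> star R (\<ominus> a) = \<ominus> star R a"
  by (metis a_inv_closed l_neg minus_equality star_add star_closed star_zero)

lemma projectionsD:
  assumes "p \<in> projections R"
  shows "p \<in> carrier R" "p \<otimes> p = p" "star R p = p"
  using assms by (auto simp: projections_def)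

lemma zero_projection: "\<zero> \<in> projections R"
  by (simp add: projections_def star_zero)

lemma compl_projection: "p \<in> projections R \<Longrightarrow> \<one> \<ominus> p \<in> projections R"
  by (auto simp: projections_def a_minus_def star_add star_minus star_one
      l_distr r_distr l_minus r_minus r_neg r_neg1)

lemma compl_mult:
  assumes "p \<in> carrier R" "x \<in> carrier R"
  shows "(\<one> \<ominus> p) \<otimes> x = x \<ominus> p \<otimes> x" "x \<otimes> (\<one> \<ominus> p) = x \<ominus> x \<otimes> p"
  using assms by (simp_all add: a_minus_def l_distr r_distr l_minus r_minus)

lemma minus_self: "x \<in> carrier R \<Longrightarrow> x \<ominus> x = \<zero>"
  by (simp add: a_minus_def r_neg)

lemma minus_eq_self_iff: "\<lbrakk>x \<in> carrier R; y \<in> carrier R\<rbrakk> \<Longrightarrow> x \<ominus> y = x \<longleftrightarrow> y = \<zero>"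
  by (metis a_inv_closed a_minus_def add.inv_eq_1_iff add.l_cancel_one)

lemma minus_eq_zero_iff: "\<lbrakk>x \<in> carrier R; y \<in> carrier R\<rbrakk> \<Longrightarrow> x \<ominus> y = \<zero> \<longleftrightarrow> x = y"
  by (metis a_inv_closed a_minus_def minus_equality minus_minus minus_self)

lemma proj_le_iff:
  assumes "e \<in> projections R" "f \<in> projections R"
  shows "proj_le R e f \<longleftrightarrow> e \<otimes> f = e"
  using assms unfolding proj_le_def projections_def
  by (smt (verit) mem_Collect_eq star_mult)

lemma proj_le_antisym:
  "\<lbrakk>e \<in> projections R; f \<in> projections R; proj_le R e f; proj_le R f e\<rbrakk> \<Longrightarrow> e = f"
  using proj_le_iff[of e f] by (simp add: proj_le_def)

lemma proj_le_refl: "e \<in> projections R \<Longrightarrow> proj_le R e e"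
  by (simp add: proj_le_def projections_def)

lemma proj_le_trans:
  "\<lbrakk>e \<in> projections R; f \<in> projections R; g \<in> projections R; proj_le R e f; proj_le R f g\<rbrakk>
    \<Longrightarrow> proj_le R e g"
  unfolding proj_le_def projections_def by (metis (no_types, lifting) m_assoc mem_Collect_eq)

lemma proj_le_compl_iff:
  assumes "e \<in> projections R" "f \<in> projections R"
  shows "proj_le R (\<one> \<ominus> f) (\<one> \<ominus> e) \<longleftrightarrow> proj_le R e f"
proof -
  have c: "e \<in> carrier R" "f \<in> carrier R"
    using assms by (auto simp: projections_def)
  have "(\<one> \<ominus> e) \<otimes> (\<one> \<ominus> f) = (\<one> \<ominus> f) \<ominus> (e \<ominus> e \<otimes> f)"
    using c compl_mult[of e "\<one> \<ominus> f"] compl_mult[of f e] by simp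
  then show ?thesis
    using c proj_le_iff[OF assms] minus_eq_zero_iff[of e "e \<otimes> f"] minus_eq_self_iff[of "\<one> \<ominus> f" "e \<ominus> e \<otimes> f"]
    by (auto simp: proj_le_def minus_self)
qed

text \<open>
  For pseudo-inverses \<open>x\<close>, \<open>y\<close> of \<open>a\<close>, the projections \<open>ax\<close> and \<open>ay\<close> generate the same right
  ideal \<open>aR\<close>, so they are equal; likewise \<open>xa = ya\<close>.
\<close>

lemma is_pinv_unique:
  assumes "a \<in> carrier R" "is_pinv R a x" "is_pinv R a y"
  shows "x = y"
proof -
  have c: "a \<in> carrier R" "x \<in> carrier R" "y \<in> carrier R"
    using assms by (auto simp: is_pinv_def)
  have x: "a \<otimes> x \<otimes> a = a" "star R (a \<otimes> x) = a \<otimes> x" "star R (x \<otimes> a) = x \<otimes> a"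
    and y: "a \<otimes> y \<otimes> a = a" "star R (a \<otimes> y) = a \<otimes> y" "star R (y \<otimes> a) = y \<otimes> a"
    using assms by (auto simp: is_pinv_def)
  have "a \<otimes> y \<otimes> a \<otimes> x = a \<otimes> y \<otimes> (a \<otimes> x)"
    using c by (simp add: m_assoc)
  also have "\<dots> = star R (a \<otimes> x \<otimes> (a \<otimes> y))"
    using c x y by (subst star_mult) simp_all
  also have "a \<otimes> x \<otimes> (a \<otimes> y) = a \<otimes> x \<otimes> a \<otimes> y"
    using c by (simp add: m_assoc)
  finally have 1: "a \<otimes> x = a \<otimes> y"
    unfolding x y .
  have "x \<otimes> (a \<otimes> y \<otimes> a) = x \<otimes> a \<otimes> (y \<otimes> a)"
    using c by (simp add: m_assoc)
  also have "\<dots> = star R (y \<otimes> a \<otimes> (x \<otimes> a))"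
    using c x y by (subst star_mult) simp_all
  also have "y \<otimes> a \<otimes> (x \<otimes> a) = y \<otimes> (a \<otimes> x \<otimes> a)"
    using c by (simp add: m_assoc)
  finally have 2: "x \<otimes> a = y \<otimes> a"
    unfolding x y .
  have "x = x \<otimes> (a \<otimes> x)" using assms c by (metis is_pinv_def m_assoc)
  also have "\<dots> = y \<otimes> a \<otimes> y" using c 1 2 by (simp flip: m_assoc)
  also have "\<dots> = y" using assms by (simp add: is_pinv_def)
  finally show ?thesis .
qed

lemma pinv_eqI: "\<lbrakk>a \<in> carrier R; is_pinv R a x\<rbrakk> \<Longrightarrow> pinv R a = x"
  unfolding pinv_def using is_pinv_unique by blast

end

section \<open>Star-clean corners\<close>

text \<open>The Peirce component \<open>pRq\<close>.\<close>

definition corner :: "('a, 'm) star_ring_scheme \<Rightarrow> 'a \<Rightarrow> 'a \<Rightarrow> 'a set" where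
  "corner R p q = {x \<in> carrier R. p \<otimes>\<^bsub>R\<^esub> x = x \<and> x \<otimes>\<^bsub>R\<^esub> q = x}"

definition inverse_in_corner :: "('a, 'm) star_ring_scheme \<Rightarrow> 'a \<Rightarrow> 'a \<Rightarrow> 'a \<Rightarrow> bool" where
  "inverse_in_corner R p x y \<longleftrightarrow>
    x \<in> corner R p p \<and> y \<in> corner R p p \<and> x \<otimes>\<^bsub>R\<^esub> y = p \<and> y \<otimes>\<^bsub>R\<^esub> x = p"

text \<open>
  For a projection \<open>p\<close> this says that the ring \<open>pRp\<close>, whose unit is \<open>p\<close>, is star-clean. It is
  phrased inside \<open>R\<close> because the corners of different projections have to be compared and added.
\<close>

definition clean_corner :: "('a, 'm) star_ring_scheme \<Rightarrow> 'a \<Rightarrow> bool" where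
  "clean_corner R p \<longleftrightarrow>
    (\<forall>a\<in>corner R p p. \<exists>x y g. inverse_in_corner R p x y \<and>
      g \<in> projections R \<and> proj_le R g p \<and> a = x \<oplus>\<^bsub>R\<^esub> g)"

context star_ring
begin

lemma cornerD:
  assumes "x \<in> corner R p q"
  shows "x \<in> carrier R" "p \<otimes> x = x" "x \<otimes> q = x"
  using assms by (auto simp: corner_def)

lemma corner_add:
  assumes "p \<in> carrier R" "q \<in> carrier R" "x \<in> corner R p q" "y \<in> corner R p q"
  shows "x \<oplus> y \<in> corner R p q"
  using assms by (simp add: corner_def l_distr r_distr)

lemma corner_minus:
  assumes "p \<in> carrier R" "q \<in> carrier R" "x \<in> corner R p q"
  shows "\<ominus> x \<in> corner R p q"
  using assms by (simp add: corner_def l_minus r_minus)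

lemma corner_mult:
  assumes "p \<in> carrier R" "r \<in> carrier R" "x \<in> corner R p q" "y \<in> corner R q r"
  shows "x \<otimes> y \<in> corner R p r"
  using assms by (auto simp: corner_def m_assoc) (simp flip: m_assoc)

lemma corner_mult_zero:
  assumes "q \<in> carrier R" "q' \<in> carrier R" "q \<otimes> q' = \<zero>" "x \<in> corner R p q" "y \<in> corner R q' r"
  shows "x \<otimes> y = \<zero>"
proof -
  have c: "x \<in> carrier R" "y \<in> carrier R" using assms by (auto simp: corner_def)
  have "x \<otimes> y = (x \<otimes> q) \<otimes> (q' \<otimes> y)" using assms by (simp add: corner_def)
  also have "\<dots> = x \<otimes> (q \<otimes> q') \<otimes> y" using assms(1,2) c by (simp add: m_assoc)
  finally show ?thesis using assms c by simp
qed

lemma corner_compress: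
  assumes "p \<in> carrier R" "p \<otimes> p = p" "q \<in> carrier R" "q \<otimes> q = q" "x \<in> carrier R"
  shows "p \<otimes> x \<otimes> q \<in> corner R p q"
  using assms by (auto simp: corner_def m_assoc) (simp flip: m_assoc)

lemma corner_mono:
  assumes "p \<in> carrier R" "q \<in> carrier R" "r \<in> carrier R" "t \<in> carrier R"
    and "p \<otimes> r = r" "t \<otimes> q = t" "x \<in> corner R r t"
  shows "x \<in> corner R p q"
proof -
  have x: "x \<in> carrier R" "r \<otimes> x = x" "x \<otimes> t = x" using cornerD[OF assms(7)] by auto
  have "p \<otimes> x = x" using assms x by (metis m_assoc)
  moreover have "x \<otimes> q = x" using assms x by (metis m_assoc)
  ultimately show ?thesis using x by (simp add: corner_def)
qed

lemma inverse_in_corner_mult: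
  assumes p: "p \<in> carrier R" and "inverse_in_corner R p x y" "inverse_in_corner R p x' y'"
  shows "inverse_in_corner R p (x \<otimes> x') (y' \<otimes> y)"
proof -
  have c: "x \<in> corner R p p" "y \<in> corner R p p" "x' \<in> corner R p p" "y' \<in> corner R p p"
    and i: "x \<otimes> y = p" "y \<otimes> x = p" "x' \<otimes> y' = p" "y' \<otimes> x' = p"
    using assms by (auto simp: inverse_in_corner_def)
  note cc = cornerD[OF c(1)] cornerD[OF c(2)] cornerD[OF c(3)] cornerD[OF c(4)]
  have "x \<otimes> x' \<otimes> (y' \<otimes> y) = x \<otimes> (x' \<otimes> y') \<otimes> y"
    using cc by (simp add: m_assoc)
  moreover have "y' \<otimes> y \<otimes> (x \<otimes> x') = y' \<otimes> (y \<otimes> x) \<otimes> x'"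
    using cc by (simp add: m_assoc)
  ultimately show ?thesis
    using cc i p c corner_mult by (simp add: inverse_in_corner_def)
qed

lemma inverse_in_corner_one_plus_square_zero:
  assumes p: "p \<in> carrier R" "p \<otimes> p = p" and n: "n \<in> corner R p p" "n \<otimes> n = \<zero>"
  shows "inverse_in_corner R p (p \<oplus> n) (p \<ominus> n)"
proof -
  note cc = cornerD[OF n(1)]
  have pp: "p \<in> corner R p p" using p by (simp add: corner_def)
  have "(p \<oplus> n) \<otimes> (p \<ominus> n) = p" "(p \<ominus> n) \<otimes> (p \<oplus> n) = p"
    using cc p n by (simp_all add: a_minus_def l_distr r_distr l_minus r_minus a_assoc l_neg r_neg)
  then show ?thesis
    using corner_add[OF p(1) p(1) pp] corner_minus[OF p(1) p(1)] n(1)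
    by (simp add: inverse_in_corner_def a_minus_def)
qed

lemma inverse_in_corner_sum:
  assumes p: "p \<in> projections R" and e: "e \<in> projections R"
    and pe: "p \<otimes> e = \<zero>" and ep: "e \<otimes> p = \<zero>"
    and u: "inverse_in_corner R p u v" and w: "inverse_in_corner R e w z"
  shows "inverse_in_corner R (p \<oplus> e) (u \<oplus> w) (v \<oplus> z)"
proof -
  note P = projectionsD[OF p] and E = projectionsD[OF e]
  have c: "u \<in> corner R p p" "v \<in> corner R p p" "w \<in> corner R e e" "z \<in> corner R e e"
    and i: "u \<otimes> v = p" "v \<otimes> u = p" "w \<otimes> z = e" "z \<otimes> w = e"
    using u w by (auto simp: inverse_in_corner_def)
  note cc = cornerD(1)[OF c(1)] cornerD(1)[OF c(2)] cornerD(1)[OF c(3)] cornerD(1)[OF c(4)]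
  have PE: "p \<in> corner R p p" "e \<in> corner R e e" using P E by (auto simp: corner_def)
  have up: "x \<in> corner R p p \<Longrightarrow> x \<in> corner R (p \<oplus> e) (p \<oplus> e)" for x
    using corner_mono[of "p \<oplus> e" "p \<oplus> e" p p x] P E pe ep by (simp add: l_distr r_distr)
  have ue: "x \<in> corner R e e \<Longrightarrow> x \<in> corner R (p \<oplus> e) (p \<oplus> e)" for x
    using corner_mono[of "p \<oplus> e" "p \<oplus> e" e e x] P E pe ep by (simp add: l_distr r_distr)
  have z1: "x \<in> corner R p p \<Longrightarrow> y \<in> corner R e e \<Longrightarrow> x \<otimes> y = \<zero>" for x y
    using corner_mult_zero[OF P(1) E(1) pe] by blast
  have z2: "x \<in> corner R e e \<Longrightarrow> y \<in> corner R p p \<Longrightarrow> x \<otimes> y = \<zero>" for x y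
    using corner_mult_zero[OF E(1) P(1) ep] by blast
  show ?thesis
    using P E cc c i up ue
    by (simp add: inverse_in_corner_def corner_add l_distr r_distr z1 z2)
qed

text \<open>
  Write an element of the corner of \<open>p + e\<close> as a block matrix with diagonal blocks \<open>pap\<close>, \<open>eae\<close>
  and off-diagonal blocks \<open>b = eap\<close>, \<open>c = pae\<close>. Once \<open>pap = u + g\<close> with \<open>u\<close> a unit with inverse
  \<open>v\<close>, subtracting \<open>g + f\<close> for a projection \<open>f \<le> e\<close> leaves a matrix that is invertible as soon
  as the Schur complement \<open>eae - bvc - f\<close> is. So \<open>f\<close> is taken from a clean decomposition of
  \<open>eae - bvc\<close>. As \<open>g\<close> and \<open>f\<close> are orthogonal, \<open>g + f\<close> is again a projection.
\<close>

lemma clean_corner_sum: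
  assumes p: "p \<in> projections R" and e: "e \<in> projections R" and pe: "p \<otimes> e = \<zero>"
    and cp: "clean_corner R p" and ce: "clean_corner R e"
  shows "clean_corner R (p \<oplus> e)"
  unfolding clean_corner_def
proof
  fix a assume a: "a \<in> corner R (p \<oplus> e) (p \<oplus> e)"
  note P = projectionsD[OF p] and E = projectionsD[OF e]
  have ep: "e \<otimes> p = \<zero>"
    using pe P E star_mult[of p e] star_zero by simp
  define q where "q = p \<oplus> e"
  have q: "q \<in> carrier R" "q \<otimes> q = q" "p \<otimes> q = p" "q \<otimes> p = p" "e \<otimes> q = e" "q \<otimes> e = e"
    using P E pe ep by (auto simp: q_def l_distr r_distr)
  have a': "a \<in> carrier R" "q \<otimes> a = a" "a \<otimes> q = a"
    using cornerD[OF a] by (auto simp: q_def)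
  have "p \<otimes> a \<otimes> p \<in> corner R p p"
    using corner_compress P a' by blast
  then obtain u v g where uv: "inverse_in_corner R p u v"
    and g: "g \<in> projections R" "proj_le R g p" and pap: "p \<otimes> a \<otimes> p = u \<oplus> g"
    using cp unfolding clean_corner_def by blast
  have u: "u \<in> corner R p p" and v: "v \<in> corner R p p" and i: "u \<otimes> v = p" "v \<otimes> u = p"
    using uv by (auto simp: inverse_in_corner_def)
  define b where "b = e \<otimes> a \<otimes> p"
  define c where "c = p \<otimes> a \<otimes> e"
  have b: "b \<in> corner R e p" and c: "c \<in> corner R p e"
    unfolding b_def c_def using corner_compress P E a' by auto
  have bv: "b \<otimes> v \<in> corner R e p" and vc: "v \<otimes> c \<in> corner R p e"
    using corner_mult P E b c v by auto
  have bvc: "b \<otimes> v \<otimes> c \<in> corner R e e"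
    using corner_mult P E bv c by auto
  have eae: "e \<otimes> a \<otimes> e \<in> corner R e e"
    using corner_compress E a' by blast
  have "e \<otimes> a \<otimes> e \<ominus> b \<otimes> v \<otimes> c \<in> corner R e e"
    unfolding a_minus_def using corner_add corner_minus E eae bvc by blast
  then obtain w z f where wz: "inverse_in_corner R e w z"
    and f: "f \<in> projections R" "proj_le R f e" and s: "e \<otimes> a \<otimes> e \<ominus> b \<otimes> v \<otimes> c = w \<oplus> f"
    using ce unfolding clean_corner_def by blast
  have w: "w \<in> corner R e e" using wz by (auto simp: inverse_in_corner_def)
  note cc = cornerD(1)[OF b] cornerD(1)[OF c] cornerD(1)[OF u] cornerD(1)[OF v] cornerD(1)[OF w]
    projectionsD(1)[OF f(1)] projectionsD(1)[OF g(1)]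
  have zz: "x \<in> corner R r p \<Longrightarrow> y \<in> corner R e t \<Longrightarrow> x \<otimes> y = \<zero>"
    "x \<in> corner R r e \<Longrightarrow> y \<in> corner R p t \<Longrightarrow> x \<otimes> y = \<zero>" for x y r t
    using corner_mult_zero[OF P(1) E(1) pe] corner_mult_zero[OF E(1) P(1) ep] by blast+
  have qc: "x \<in> corner R r t \<Longrightarrow> r \<in> {p, e} \<Longrightarrow> t \<in> {p, e} \<Longrightarrow> x \<in> corner R q q" for x r t
    using corner_mono[of q q r t x] P(1) E(1) q by auto
  have eae': "e \<otimes> a \<otimes> e = w \<oplus> f \<oplus> b \<otimes> v \<otimes> c"
    using s cc E a' by (metis a_minus_def a_inv_closed a_assoc l_neg m_closed r_zero)
  \<comment> \<open>The factorisation of \<open>a - (g + f)\<close> into a lower triangular,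
      a diagonal and an upper triangular block matrix.\<close>
  define U where "U = (q \<oplus> b \<otimes> v) \<otimes> (u \<oplus> w) \<otimes> (q \<oplus> v \<otimes> c)"
  \<comment> \<open>Its inverse, factor by factor in the opposite order.\<close>
  define V where "V = (q \<ominus> v \<otimes> c) \<otimes> ((v \<oplus> z) \<otimes> (q \<ominus> b \<otimes> v))"
  have "inverse_in_corner R q (q \<oplus> b \<otimes> v) (q \<ominus> b \<otimes> v)"
    using inverse_in_corner_one_plus_square_zero[OF q(1,2)] qc[OF bv] zz(1)[OF bv bv] by simp
  moreover have "inverse_in_corner R q (q \<oplus> v \<otimes> c) (q \<ominus> v \<otimes> c)"
    using inverse_in_corner_one_plus_square_zero[OF q(1,2)] qc[OF vc] zz(2)[OF vc vc] by simp
  moreover have "inverse_in_corner R q (u \<oplus> w) (v \<oplus> z)"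
    unfolding q_def by (rule inverse_in_corner_sum[OF p e pe ep uv wz])
  ultimately have UV: "inverse_in_corner R q U V"
    unfolding U_def V_def using inverse_in_corner_mult q(1) by metis
  have 1: "q \<otimes> u = u" "q \<otimes> w = w"
    using qc[OF u] qc[OF w] by (auto simp: corner_def)
  have 2: "b \<otimes> v \<otimes> u = b" "b \<otimes> v \<otimes> w = \<zero>"
    using zz(1)[OF bv w] cc i cornerD[OF b] by (auto simp: m_assoc)
  have 3: "u \<otimes> (v \<otimes> c) = c" "w \<otimes> (v \<otimes> c) = \<zero>" "b \<otimes> (v \<otimes> c) = b \<otimes> v \<otimes> c"
    using zz(2)[OF w vc] cc i cornerD[OF c] by (auto simp flip: m_assoc)
  have 4: "u \<otimes> q = u" "w \<otimes> q = w" "b \<otimes> q = b"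
    using qc[OF u] qc[OF w] qc[OF b] by (auto simp: corner_def)
  have "U = (u \<oplus> w \<oplus> b) \<otimes> (q \<oplus> v \<otimes> c)"
    unfolding U_def using cc q(1) 1 2 by (simp add: l_distr r_distr a_ac)
  also have "\<dots> = u \<oplus> w \<oplus> b \<oplus> c \<oplus> b \<otimes> v \<otimes> c"
    using cc q(1) 3 4 by (simp add: l_distr r_distr a_ac)
  finally have U: "U = u \<oplus> w \<oplus> b \<oplus> c \<oplus> b \<otimes> v \<otimes> c" .
  have "a = q \<otimes> a \<otimes> q"
    using a' by simp
  also have "\<dots> = (p \<otimes> a \<otimes> p \<oplus> b) \<oplus> (c \<oplus> e \<otimes> a \<otimes> e)"
    unfolding q_def b_def c_def using P E a' by (simp add: l_distr r_distr a_ac)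
  also have "\<dots> = U \<oplus> (g \<oplus> f)"
    unfolding pap eae' U using cc by (simp add: a_ac)
  finally have aU: "a = U \<oplus> (g \<oplus> f)" .
  have g': "g \<in> corner R p p" and f': "f \<in> corner R e e"
    using g f p e proj_le_iff projectionsD by (auto simp: corner_def proj_le_def)
  have "g \<oplus> f \<in> projections R"
    using zz(1)[OF g' f'] zz(2)[OF f' g'] projectionsD[OF g(1)] projectionsD[OF f(1)]
    by (simp add: projections_def l_distr r_distr star_add)
  moreover have "proj_le R (g \<oplus> f) q"
    using qc[OF g'] qc[OF f'] cc q(1) by (simp add: proj_le_def corner_def r_distr)
  ultimately show "\<exists>x y h. inverse_in_corner R (p \<oplus> e) x y \<and> h \<in> projections R \<and>
      proj_le R h (p \<oplus> e) \<and> a = x \<oplus> h"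
    using UV aU unfolding q_def by blast
qed

end

context star_regular_ring
begin

lemma proper': "\<lbrakk>a \<in> carrier R; star R a \<otimes> a = \<zero>\<rbrakk> \<Longrightarrow> a = \<zero>"
  using proper[of "star R a"] star_star star_zero by (metis star_closed)

text \<open>
  If \<open>y\<close> is an inner inverse of \<open>a\<^sup>* a\<close>, then \<open>a y a\<^sup>*\<close> acts as the orthogonal projection onto
  \<open>aR\<close> (the normal equations of least squares); properness is what allows \<open>a\<^sup>*\<close> to be cancelled.
\<close>

lemma ex_inner_inverse_projection:
  assumes a: "a \<in> carrier R"
  shows "\<exists>c\<in>carrier R. a \<otimes> c \<otimes> a = a \<and> star R (a \<otimes> c) = a \<otimes> c"
proof -
  let ?s = "star R a"
  have s: "?s \<in> carrier R" using a by simp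
  obtain y where y: "y \<in> carrier R" "(?s \<otimes> a) \<otimes> y \<otimes> (?s \<otimes> a) = ?s \<otimes> a"
    using regular[of "?s \<otimes> a"] a by auto
  define c where "c = y \<otimes> ?s"
  have c: "c \<in> carrier R" using y s by (simp add: c_def)
  define d where "d = a \<otimes> c \<otimes> a \<ominus> a"
  have d: "d \<in> carrier R" using a c by (simp add: d_def)
  have "?s \<otimes> d = (?s \<otimes> a) \<otimes> y \<otimes> (?s \<otimes> a) \<ominus> ?s \<otimes> a"
    unfolding d_def c_def using a s y(1) by (simp add: a_minus_def r_distr r_minus m_assoc)
  then have sd: "?s \<otimes> d = \<zero>" using y a by (simp add: minus_self)
  have "star R d = star R (a \<otimes> c \<otimes> a) \<ominus> ?s"
    unfolding d_def using a c by (simp add: a_minus_def star_add star_minus)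
  also have "\<dots> = (?s \<otimes> star R c \<ominus> \<one>) \<otimes> ?s"
    using a c by (simp add: star_mult a_minus_def l_distr l_minus m_assoc)
  finally have "star R d \<otimes> d = (?s \<otimes> star R c \<ominus> \<one>) \<otimes> (?s \<otimes> d)"
    using a c d by (simp add: m_assoc)
  then have "star R d \<otimes> d = \<zero>"
    using sd a c by simp
  then have "d = \<zero>" using proper' d by blast
  then have aca: "a \<otimes> c \<otimes> a = a"
    unfolding d_def using a c minus_eq_zero_iff by simp
  define t where "t = a \<otimes> c"
  have t: "t \<in> carrier R" using a c by (simp add: t_def)
  have "t \<otimes> star R t = a \<otimes> c \<otimes> a \<otimes> star R y \<otimes> ?s"
    unfolding t_def using a c y s by (simp add: c_def star_mult star_star m_assoc)
  also have "\<dots> = star R t"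
    unfolding aca using a y by (simp add: t_def c_def star_mult star_star m_assoc)
  finally have "t \<otimes> star R t = star R t" .
  then have "star R t = t"
    using t star_mult[of t "star R t"] star_star[of t] by simp
  then show ?thesis using c aca unfolding t_def by blast
qed

text \<open>
  One inner inverse \<open>c\<close> makes \<open>ac\<close> a projection and another one, \<open>d\<close>, obtained from \<open>a\<^sup>*\<close>, makes
  \<open>da\<close> a projection; \<open>d a c\<close> inherits both properties.
\<close>

lemma is_pinv_pinv:
  assumes a: "a \<in> carrier R"
  shows "is_pinv R a (pinv R a)"
proof -
  obtain c where c: "c \<in> carrier R" "a \<otimes> c \<otimes> a = a" "star R (a \<otimes> c) = a \<otimes> c"
    using ex_inner_inverse_projection[OF a] by blast
  obtain b where b: "b \<in> carrier R" "star R a \<otimes> b \<otimes> star R a = star R a"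
      "star R (star R a \<otimes> b) = star R a \<otimes> b"
    using ex_inner_inverse_projection[of "star R a"] a by auto
  define d where "d = star R b"
  have d: "d \<in> carrier R" using b by (simp add: d_def)
  have da: "d \<otimes> a = star R a \<otimes> b"
    using b a by (simp add: d_def star_mult star_star)
  have "a \<otimes> (d \<otimes> a) = star R (star R a \<otimes> b \<otimes> star R a)"
    unfolding da using a b(1,3) by (simp add: star_mult[of "star R a \<otimes> b" "star R a"] star_star)
  then have ada: "a \<otimes> d \<otimes> a = a"
    using a b(2) d by (simp add: star_star m_assoc)
  have sda: "star R (d \<otimes> a) = d \<otimes> a"
    unfolding da by (rule b(3))
  define x where "x = d \<otimes> (a \<otimes> c)"
  have x: "x \<in> carrier R" using a c d by (simp add: x_def)
  have ax: "a \<otimes> x = a \<otimes> c"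
    using a c d ada by (simp add: x_def flip: m_assoc)
  have xa: "x \<otimes> a = d \<otimes> a"
    using a c d by (simp add: x_def m_assoc)
  have "x \<otimes> a \<otimes> x = x"
    unfolding xa using a c d ada x by (simp add: x_def flip: m_assoc) (simp add: m_assoc)
  then have "is_pinv R a x"
    unfolding is_pinv_def using ax xa c sda x by simp
  then show ?thesis using pinv_eqI[OF a] by simp
qed

lemma pinv_closed [simp]: "a \<in> carrier R \<Longrightarrow> pinv R a \<in> carrier R"
  using is_pinv_pinv by (auto simp: is_pinv_def)

lemma pinv_mult:
  assumes "a \<in> carrier R"
  shows "a \<otimes> pinv R a \<otimes> a = a" "pinv R a \<otimes> a \<otimes> pinv R a = pinv R a"
    "a \<otimes> pinv R a \<in> projections R" "pinv R a \<otimes> a \<in> projections R"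
proof -
  note P = is_pinv_pinv[OF assms, unfolded is_pinv_def]
  show 1: "a \<otimes> pinv R a \<otimes> a = a" "pinv R a \<otimes> a \<otimes> pinv R a = pinv R a"
    using P by auto
  show "a \<otimes> pinv R a \<in> projections R" "pinv R a \<otimes> a \<in> projections R"
    using P assms 1 by (auto simp: projections_def simp flip: m_assoc)
qed

end

section \<open>Chain conditions on projections\<close>

lemma (in star_ring) proj_chain_has_greatest:
  assumes "finite C" "C \<noteq> {}" "proj_chain R C"
  shows "\<exists>m\<in>C. \<forall>c\<in>C. proj_le R c m"
  using assms
proof (induction C rule: finite_ne_induct)
  case (singleton x)
  then show ?case by (simp add: proj_chain_def)
next
  case (insert x C)
  then obtain m where m: "m \<in> C" "\<forall>c\<in>C. proj_le R c m"
    by (auto simp: proj_chain_def)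
  have p: "insert x C \<subseteq> projections R" "proj_le R x m \<or> proj_le R m x" "proj_le R x x"
    using insert.prems m by (auto simp: proj_chain_def)
  show ?case
  proof (cases "proj_le R x m")
    case True
    then show ?thesis using m by auto
  next
    case False
    then have "proj_le R c x" if "c \<in> C" for c
      using p m that proj_le_trans[of c m x] by blast
    then show ?thesis using p by auto
  qed
qed

text \<open>
  The greatest element of a longest chain in \<open>P\<close> is maximal, since anything above it would
  prolong the chain.
\<close>

lemma (in star_ring) artinian_has_maximal:
  assumes art: "artinian R" and P: "P \<subseteq> projections R" "P \<noteq> {}"
  shows "\<exists>m\<in>P. \<forall>q\<in>P. proj_le R m q \<longrightarrow> q = m"
proof -
  obtain n where n: "\<And>C. proj_chain R C \<Longrightarrow> finite C \<and> card C \<le> n"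
    using art by (auto simp: artinian_def)
  define T where "T C \<longleftrightarrow> C \<subseteq> P \<and> C \<noteq> {} \<and> proj_chain R C" for C
  obtain p where "p \<in> P" using P by blast
  then have "T {p}"
    using P proj_le_refl by (auto simp: T_def proj_chain_def)
  moreover have "\<forall>D. T D \<longrightarrow> card D < Suc n"
    using n by (simp add: T_def less_Suc_eq_le)
  ultimately obtain C where C: "T C" "\<And>D. T D \<Longrightarrow> card D \<le> card C"
    using ex_has_greatest_nat[of T "{p}" card "Suc n"] by metis
  then have fin: "finite C" using n by (auto simp: T_def)
  obtain m where m: "m \<in> C" "\<forall>c\<in>C. proj_le R c m"
    using C(1) fin proj_chain_has_greatest[of C] unfolding T_def by blast
  have "q = m" if q: "q \<in> P" "proj_le R m q" for q
  proof (rule ccontr)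
    assume ne: "q \<noteq> m"
    have sub: "C \<subseteq> projections R" "q \<in> projections R" "m \<in> projections R"
      using C(1) P q m by (auto simp: T_def)
    then have le: "proj_le R c q" if "c \<in> C" for c
      using that m q proj_le_trans[of c m q] by blast
    have "q \<notin> C" using ne m q sub proj_le_antisym by blast
    moreover have "T (insert q C)"
      using C(1) q le sub proj_le_refl by (auto simp: T_def proj_chain_def)
    ultimately show False
      using C(2)[of "insert q C"] fin by simp
  qed
  then show ?thesis using m(1) C(1) unfolding T_def by blast
qed

text \<open>Complementation reverses the order of projections.\<close>

lemma (in star_ring) artinian_has_minimal:
  assumes art: "artinian R" and P: "P \<subseteq> projections R" "P \<noteq> {}"
  shows "\<exists>m\<in>P. \<forall>q\<in>P. proj_le R q m \<longrightarrow> q = m"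
proof -
  let ?c = "\<lambda>p. \<one> \<ominus> p"
  have "?c ` P \<subseteq> projections R" "?c ` P \<noteq> {}"
    using P compl_projection by auto
  then obtain m where m: "m \<in> P" "\<forall>q\<in>P. proj_le R (?c m) (?c q) \<longrightarrow> ?c q = ?c m"
    using artinian_has_maximal[OF art, of "?c ` P"] by auto
  have "q = m" if "q \<in> P" "proj_le R q m" for q
  proof (rule proj_le_antisym)
    show "q \<in> projections R" "m \<in> projections R" "proj_le R q m" using that m P by auto
    then have "?c q = ?c m" "?c m \<in> projections R"
      using m that proj_le_compl_iff[of q m] compl_projection by auto
    then show "proj_le R m q"
      using proj_le_compl_iff[of m q] proj_le_refl[of "?c m"] \<open>q \<in> projections R\<close> \<open>m \<in> projections R\<close>
      by simp
  qed
  then show ?thesis using m by blast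
qed

section \<open>Artinian star-regular rings are star-clean\<close>

context star_regular_ring
begin

text \<open>
  For nonzero \<open>a \<in> eRe\<close>, both \<open>a a\<^sup>+\<close> and \<open>a\<^sup>+ a\<close> are nonzero projections below \<open>e\<close>, hence equal to
  \<open>e\<close>; so \<open>eRe\<close> is a division ring.
\<close>

lemma clean_corner_minimal:
  assumes e: "e \<in> projections R"
    and min: "\<And>q. \<lbrakk>q \<in> projections R; q \<noteq> \<zero>; proj_le R q e\<rbrakk> \<Longrightarrow> q = e"
  shows "clean_corner R e"
  unfolding clean_corner_def
proof
  fix a assume a: "a \<in> corner R e e"
  note E = projectionsD[OF e] and A = cornerD[OF a]
  show "\<exists>x y g. inverse_in_corner R e x y \<and> g \<in> projections R \<and> proj_le R g e \<and> a = x \<oplus> g"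
  proof (cases "a = \<zero>")
    case True
    have "\<ominus> e \<in> corner R e e" "a = \<ominus> e \<oplus> e"
      using E True by (auto simp: corner_def l_minus r_minus l_neg)
    moreover have "\<ominus> e \<otimes> \<ominus> e = e"
      using E by (simp add: l_minus r_minus)
    ultimately show ?thesis
      using e proj_le_refl[OF e]
      by (intro exI[of _ "\<ominus> e"] exI[of _ e]) (simp add: inverse_in_corner_def)
  next
    case False
    define b where "b = pinv R a"
    note pm = pinv_mult[OF A(1), folded b_def]
    have b: "b \<in> carrier R" using A by (simp add: b_def)
    have nz: "a \<otimes> b \<noteq> \<zero>" "b \<otimes> a \<noteq> \<zero>"
      using pm(1) pm(1)[unfolded m_assoc[OF A(1) b A(1)]] False A by auto
    have "e \<otimes> (a \<otimes> b) = a \<otimes> b"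
      using A E b by (simp flip: m_assoc)
    then have ab: "a \<otimes> b = e"
      using min[OF pm(3) nz(1)] by (simp add: proj_le_def)
    have "b \<otimes> a \<otimes> e = b \<otimes> a"
      using A E b by (simp add: m_assoc)
    then have ba: "b \<otimes> a = e"
      using min[OF pm(4) nz(2)] proj_le_iff[OF pm(4) e] by simp
    have "b \<in> corner R e e"
      using pm(2) m_assoc[OF b A(1) b] ab ba b by (simp add: corner_def)
    then have "inverse_in_corner R e a b"
      using a ab ba by (simp add: inverse_in_corner_def)
    then show ?thesis
      using zero_projection A E by (intro exI[of _ a] exI[of _ b] exI[of _ \<zero>]) (simp add: proj_le_def)
  qed
qed

lemma clean_corner_zero: "clean_corner R \<zero>"
  by (rule clean_corner_minimal) (auto simp: zero_projection proj_le_def projections_def star_zero)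

text \<open>
  A maximal projection with star-clean corner is \<open>1\<close>, for otherwise it could be enlarged by a minimal
  projection orthogonal to it.
\<close>

theorem artinian_star_clean:
  assumes art: "artinian R"
  shows "star_clean R"
proof -
  let ?P = "{p \<in> projections R. clean_corner R p}"
  have "\<zero> \<in> ?P" using zero_projection clean_corner_zero by simp
  then obtain p where p: "p \<in> projections R" "clean_corner R p"
    and pmax: "\<And>q. \<lbrakk>q \<in> projections R; clean_corner R q; proj_le R p q\<rbrakk> \<Longrightarrow> q = p"
    using artinian_has_maximal[OF art, of ?P] by auto
  note P = projectionsD[OF p(1)]
  have "p = \<one>"
  proof (rule ccontr)
    assume "p \<noteq> \<one>"
    let ?Q = "{e \<in> projections R. e \<noteq> \<zero> \<and> proj_le R e (\<one> \<ominus> p)}"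
    have "\<one> \<ominus> p \<in> ?Q"
      using \<open>p \<noteq> \<one>\<close> P p compl_projection proj_le_refl minus_eq_zero_iff[of \<one> p] by auto
    then obtain e where e: "e \<in> projections R" "e \<noteq> \<zero>" "proj_le R e (\<one> \<ominus> p)"
      and emin: "\<And>q. \<lbrakk>q \<in> ?Q; proj_le R q e\<rbrakk> \<Longrightarrow> q = e"
      using artinian_has_minimal[OF art, of ?Q] by auto
    note E = projectionsD[OF e(1)]
    have "clean_corner R e"
      using proj_le_trans[OF _ e(1) compl_projection[OF p(1)] _ e(3)] emin
      by (intro clean_corner_minimal e(1)) blast
    moreover have pe: "p \<otimes> e = \<zero>"
      using e(3) P E compl_mult(1)[of p e] minus_eq_self_iff[of e "p \<otimes> e"]
      by (simp add: proj_le_def)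
    ultimately have "clean_corner R (p \<oplus> e)"
      using clean_corner_sum p e by blast
    moreover have ep: "e \<otimes> p = \<zero>"
      using pe P E star_mult[of p e] star_zero by simp
    have "p \<oplus> e \<in> projections R" "proj_le R p (p \<oplus> e)"
      using P E pe ep by (simp_all add: projections_def proj_le_def l_distr r_distr star_add)
    ultimately have "p \<oplus> e = p" using pmax by blast
    then show False using e P E by simp
  qed
  show ?thesis
    unfolding star_clean_def
  proof
    fix a assume "a \<in> carrier R"
    then have "a \<in> corner R p p" using \<open>p = \<one>\<close> by (simp add: corner_def)
    then obtain x y g where "inverse_in_corner R p x y" "g \<in> projections R" "a = x \<oplus> g"
      using p(2) unfolding clean_corner_def by blast
    then show "\<exists>u\<in>Units R. \<exists>e\<in>projections R. a = u \<oplus> e"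
      using \<open>p = \<one>\<close> by (auto simp: inverse_in_corner_def corner_def Units_def)
  qed
qed

section \<open>Artinian star-regular rings are unit-regular\<close>

text \<open>
  The projections \<open>b\<^sup>n (b\<^sup>n)\<^sup>+\<close> onto the right ideals \<open>b\<^sup>n R\<close> form a descending chain.
\<close>

lemma artinian_power_stabilizes:
  assumes art: "artinian R" and b: "b \<in> carrier R"
  shows "\<exists>n::nat. \<exists>t\<in>carrier R. b [^] n = b [^] Suc n \<otimes> t"
proof -
  let ?l = "\<lambda>n::nat. b [^] n \<otimes> pinv R (b [^] n)"
  have bn: "b [^] n \<in> carrier R" for n :: nat using b by simp
  have l: "?l n \<in> projections R" for n using pinv_mult[OF bn] by blast
  obtain n where n: "\<And>k. proj_le R (?l k) (?l n) \<Longrightarrow> ?l k = ?l n"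
    using artinian_has_minimal[OF art, of "range ?l"] l by auto
  have "b [^] Suc n = b [^] n \<otimes> b" by simp
  then have "?l n \<otimes> b [^] Suc n = b [^] Suc n"
    using pinv_mult(1)[OF bn, of n] bn b by (simp flip: m_assoc)
  then have "proj_le R (?l (Suc n)) (?l n)"
    unfolding proj_le_def using bn pinv_closed[OF bn] by (metis m_assoc m_closed)
  then have "?l (Suc n) = ?l n" using n by blast
  then have "b [^] n = ?l (Suc n) \<otimes> b [^] n"
    using pinv_mult(1)[OF bn, of n] by simp
  also have "\<dots> = b [^] Suc n \<otimes> (pinv R (b [^] Suc n) \<otimes> b [^] n)"
    using bn[of n] bn[of "Suc n"] by (intro m_assoc pinv_closed)
  finally show ?thesis using bn[of n] bn[of "Suc n"] pinv_closed m_closed by blast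
qed

text \<open>
  Hypothesis \<open>inj\<close> says that \<open>c\<close> is a left inverse of \<open>b\<close> on \<open>Re\<close>, a left ideal stable under \<open>b\<close>.
  So \<open>b\<^sup>n\<close> is cancellable there, and \<open>b\<^sup>n = b\<^sup>n b t\<close> yields \<open>e = b t e\<close>: thus \<open>e\<close>
  lies in \<open>bR\<close>, which \<open>e\<close> annihilates from the left. It plays the part of the fact that an
  injective endomorphism of a module of finite length is surjective.
\<close>

lemma artinian_complement_zero:
  assumes art: "artinian R" and c: "b \<in> carrier R" "c \<in> carrier R" "e \<in> carrier R"
    and ee: "e \<otimes> e = e" and eb: "e \<otimes> b = \<zero>"
    and inj: "\<And>z. z \<in> carrier R \<Longrightarrow> c \<otimes> b \<otimes> z \<otimes> e = z \<otimes> e"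
  shows "e = \<zero>"
proof -
  obtain n t where t: "t \<in> carrier R" "b [^] (n::nat) = b [^] Suc n \<otimes> t"
    using artinian_power_stabilizes[OF art c(1)] by blast
  have cancel: "c [^] k \<otimes> (b [^] k \<otimes> (z \<otimes> e)) = z \<otimes> e" if z: "z \<in> carrier R" for k :: nat and z
  proof (induction k)
    case 0
    then show ?case using c z by simp
  next
    case (Suc k)
    have "c [^] Suc k \<otimes> (b [^] Suc k \<otimes> (z \<otimes> e)) = c [^] k \<otimes> (c \<otimes> b \<otimes> (b [^] k \<otimes> z) \<otimes> e)"
      unfolding nat_pow_Suc2[OF c(1)] using c z by (simp add: m_assoc)
    then show ?case
      using Suc inj[of "b [^] k \<otimes> z"] c z by (simp add: m_assoc)
  qed
  have "b [^] n = b [^] n \<otimes> (b \<otimes> t)"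
    using t c m_assoc[of "b [^] n" b t] by simp
  then have absorb: "b [^] n \<otimes> e = b [^] n \<otimes> (b \<otimes> t \<otimes> e)"
    using t(1) c m_assoc[of "b [^] n" "b \<otimes> t" e] by simp
  have "e = c [^] n \<otimes> (b [^] n \<otimes> (\<one> \<otimes> e))"
    using cancel[of \<one> n] c by simp
  also have "\<dots> = c [^] n \<otimes> (b [^] n \<otimes> ((b \<otimes> t) \<otimes> e))"
    using absorb c by simp
  also have "\<dots> = b \<otimes> t \<otimes> e"
    using cancel c t by simp
  finally have "e \<otimes> e = (e \<otimes> b) \<otimes> (t \<otimes> e)"
    using c t by (simp add: m_assoc)
  then show ?thesis using ee eb c t by simp
qed

text \<open>
  The candidates \<open>b\<close> agree with \<open>a\<close> on the right support \<open>r\<close> of \<open>a\<close>, and have the same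
  component as \<open>a\<close> along its left support \<open>l\<close>. If such a \<open>b\<close> is a unit, then
  \<open>a b\<^sup>-\<^sup>1 a = l b b\<^sup>-\<^sup>1 a = l a = a\<close>.
\<close>

theorem artinian_unit_regular:
  assumes art: "artinian R"
  shows "unit_regular R"
  unfolding unit_regular_def
proof
  fix a assume a: "a \<in> carrier R"
  define l where "l = a \<otimes> pinv R a"
  define r where "r = pinv R a \<otimes> a"
  have l: "l \<in> carrier R" "l \<otimes> a = a" and r: "r \<in> carrier R" "a \<otimes> r = a"
    using a pinv_mult(1)[OF a] by (auto simp: l_def r_def m_assoc)
  let ?B = "{b \<in> carrier R. l \<otimes> b = a \<and> b \<otimes> r = a}"
  let ?L = "\<lambda>b. b \<otimes> pinv R b"
  have "a \<in> ?B" using a l r by simp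
  moreover have "?L ` ?B \<subseteq> projections R" using pinv_mult by auto
  ultimately obtain b where b: "b \<in> carrier R" "l \<otimes> b = a" "b \<otimes> r = a"
    and bmax: "\<And>b'. \<lbrakk>b' \<in> ?B; proj_le R (?L b) (?L b')\<rbrakk> \<Longrightarrow> ?L b' = ?L b"
    using artinian_has_maximal[OF art, of "?L ` ?B"] by auto
  define c where "c = pinv R b"
  define e where "e = \<one> \<ominus> b \<otimes> c"
  define f where "f = \<one> \<ominus> c \<otimes> b"
  have c: "c \<in> carrier R" using b by (simp add: c_def)
  note pm = pinv_mult[OF b(1), folded c_def]
  have ep: "e \<in> projections R" and fp: "f \<in> projections R"
    using pm(3,4) compl_projection by (auto simp: e_def f_def)
  note E = projectionsD[OF ep] and F = projectionsD[OF fp]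
  have eb: "e \<otimes> b = \<zero>" and bf: "b \<otimes> f = \<zero>"
    using b c pm(1) by (simp_all add: e_def f_def compl_mult m_assoc minus_self)
  have fc: "f \<otimes> c = \<zero>"
    using b c pm(2) by (simp add: f_def compl_mult minus_self)
  have la: "l = b \<otimes> r \<otimes> pinv R a"
    using b by (simp add: l_def)
  have el: "e \<otimes> l = \<zero>"
  proof -
    have "e \<otimes> l = (e \<otimes> b) \<otimes> (r \<otimes> pinv R a)"
      unfolding la using m_assoc[of e "b \<otimes> r" "pinv R a"] m_assoc[of b r "pinv R a"]
        m_assoc[of e b "r \<otimes> pinv R a"] a b(1) r(1) E(1) by simp
    then show ?thesis using eb a r by simp
  qed
  then have le: "l \<otimes> e = \<zero>"
    using projectionsD[OF pinv_mult(3)[OF a], folded l_def] E l star_mult[of e l] star_zero by simp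
  have "a \<otimes> f = l \<otimes> (b \<otimes> f)"
    using b(2) m_assoc[OF l(1) b(1) F(1)] by simp
  then have "r \<otimes> f = \<zero>"
    using bf a l F by (simp add: r_def m_assoc)
  then have fr: "f \<otimes> r = \<zero>"
    using projectionsD[OF pinv_mult(4)[OF a], folded r_def] F r star_mult[of r f] star_zero by simp
  have exf: "e \<otimes> x \<otimes> f = \<zero>" if x: "x \<in> carrier R" for x
  proof -
    define z where "z = e \<otimes> x \<otimes> f"
    have z: "z \<in> carrier R" using x E F by (simp add: z_def)
    have ez: "e \<otimes> z = z" using x E F by (simp add: z_def flip: m_assoc)
    have zf: "z \<otimes> f = z" using x E F by (simp add: z_def m_assoc)
    have "l \<otimes> z = (l \<otimes> e) \<otimes> (x \<otimes> f)" using x E F l by (simp add: z_def m_assoc)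
    then have lz: "l \<otimes> z = \<zero>" using le x F by simp
    have "z \<otimes> r = (e \<otimes> x) \<otimes> (f \<otimes> r)" using x E F r by (simp add: z_def m_assoc)
    then have zr: "z \<otimes> r = \<zero>" using fr x E by simp
    have "z \<otimes> c = (e \<otimes> x) \<otimes> (f \<otimes> c)" using x E F c by (simp add: z_def m_assoc)
    then have zc: "z \<otimes> c = \<zero>" using fc x E by simp
    \<comment> \<open>Since \<open>z\<close> lives on the complements of both supports of \<open>b\<close>, the sum \<open>b + z\<close> is again
      a candidate and its left support contains those of \<open>b\<close> and of \<open>z\<close>. By maximality \<open>z = 0\<close>.\<close>
    define b' where "b' = b \<oplus> z"
    have b': "b' \<in> carrier R" using b z by (simp add: b'_def)
    note pm' = pinv_mult[OF b']
    have "b' \<in> ?B" using b z l r lz zr a by (simp add: b'_def l_distr r_distr)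
    moreover have "b' \<otimes> c = b \<otimes> c" using b z c zc by (simp add: b'_def l_distr)
    then have "?L b' \<otimes> (b \<otimes> c) = b \<otimes> c"
      using pm'(1) b' c by (metis m_assoc m_closed pinv_closed)
    ultimately have L: "?L b' = b \<otimes> c" using bmax[of b'] by (simp add: proj_le_def c_def)
    have "b' \<otimes> f = z" using bf zf b z F by (simp add: b'_def l_distr)
    then have "?L b' \<otimes> z = z"
      using pm'(1) b' F by (metis m_assoc m_closed pinv_closed)
    then have "b \<otimes> c \<otimes> z = z" using L by simp
    moreover have "b \<otimes> c \<otimes> z = \<zero>"
      using ez z b c minus_eq_self_iff[of z "b \<otimes> c \<otimes> z"] by (simp add: e_def compl_mult)
    ultimately show ?thesis by (simp add: z_def)
  qed
  have fxe: "f \<otimes> x \<otimes> e = \<zero>" if x: "x \<in> carrier R" for x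
  proof -
    have "f \<otimes> x \<otimes> e = star R (e \<otimes> star R x \<otimes> f)"
      using x E F by (simp add: star_mult star_star m_assoc)
    then show ?thesis using exf[of "star R x"] x star_zero by simp
  qed
  have "e = \<zero>"
  proof (rule artinian_complement_zero[OF art b(1) c E(1,2) eb])
    fix z assume z: "z \<in> carrier R"
    have "f \<otimes> (z \<otimes> e) = z \<otimes> e \<ominus> c \<otimes> b \<otimes> (z \<otimes> e)"
      unfolding f_def using z E b c by (simp add: compl_mult)
    then show "c \<otimes> b \<otimes> z \<otimes> e = z \<otimes> e"
      using fxe[OF z] z E F b c minus_eq_zero_iff[of "z \<otimes> e" "c \<otimes> b \<otimes> (z \<otimes> e)"] by (simp add: m_assoc)
  qed
  \<comment> \<open>The same argument for \<open>b\<^sup>*\<close>, whose supports are those of \<open>b\<close> interchanged.\<close>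
  moreover have "f = \<zero>"
  proof (rule artinian_complement_zero[OF art, of "star R b" "star R c"])
    show "f \<otimes> star R b = \<zero>"
      using bf b F star_mult[of b f] star_zero by simp
    fix z assume z: "z \<in> carrier R"
    have "star R c \<otimes> star R b = b \<otimes> c"
      using projectionsD(3)[OF pm(3)] b c by (simp add: star_mult)
    moreover have "e \<otimes> (z \<otimes> f) = z \<otimes> f \<ominus> b \<otimes> c \<otimes> (z \<otimes> f)"
      unfolding e_def using z F b c by (simp add: compl_mult)
    ultimately show "star R c \<otimes> star R b \<otimes> z \<otimes> f = z \<otimes> f"
      using exf[OF z] z E F b c minus_eq_zero_iff[of "z \<otimes> f" "b \<otimes> c \<otimes> (z \<otimes> f)"] by (simp add: m_assoc)
  qed (use b c F in auto)
  ultimately have bc: "b \<otimes> c = \<one>" "c \<otimes> b = \<one>"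
    using b c minus_eq_zero_iff[of \<one> "b \<otimes> c"] minus_eq_zero_iff[of \<one> "c \<otimes> b"] by (auto simp: e_def f_def)
  then have "c \<in> Units R" using b c by (auto simp: Units_def)
  moreover have "a \<otimes> c \<otimes> a = a"
    using m_assoc[OF l(1) b(1) c] b(2) bc l by simp
  ultimately show "\<exists>u\<in>Units R. a \<otimes> u \<otimes> a = a" by blast
qed

end

section \<open>Quotients\<close>

context star_regular_ring
begin

text \<open>
  With \<open>p = a a\<^sup>+ \<in> I\<close> self-adjoint and \<open>pa = a\<close>, the element \<open>a\<^sup>* = a\<^sup>* p\<close> lies in \<open>I\<close>.
\<close>

lemma star_mem_ideal:
  assumes I: "ideal I R" and a: "a \<in> I"
  shows "star R a \<in> I"
proof -
  interpret I: ideal I R by fact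
  have c: "a \<in> carrier R" using a by simp
  let ?p = "a \<otimes> pinv R a"
  have p: "?p \<in> I" "star R ?p = ?p"
    using I.I_r_closed[OF a] pinv_closed[OF c] projectionsD(3) pinv_mult(3)[OF c] by blast+
  have "star R a = star R (?p \<otimes> a)"
    using pinv_mult(1)[OF c] by simp
  also have "\<dots> = star R a \<otimes> ?p"
    using c p by (subst star_mult) simp_all
  finally show ?thesis
    using I.I_l_closed[OF p(1), of "star R a"] c by simp
qed

lemma star_coset:
  assumes I: "ideal I R" and x: "x \<in> carrier R"
  shows "star R ` (I +> x) = I +> star R x"
proof -
  interpret I: ideal I R by fact
  have 1: "star R ` (I +> y) \<subseteq> I +> star R y" if "y \<in> carrier R" for y
    using that star_mem_ideal[OF I] by (auto simp: a_r_coset_def' star_add I.Icarr intro!: exI)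
  have "star R ` (star R ` (I +> star R x)) = I +> star R x"
  proof -
    have "star R (star R y) = y" if "y \<in> I +> star R x" for y
      using that x by (auto simp: a_r_coset_def' I.Icarr star_star)
    then show ?thesis by (force simp: image_image)
  qed
  moreover have "star R ` (I +> star R x) \<subseteq> I +> x"
    using 1[of "star R x"] x by (simp add: star_star)
  ultimately show ?thesis using 1[OF x] by blast
qed

lemma coset_hom:
  assumes I: "ideal I R"
  shows "(+>) I \<in> star_ring_hom R (star_quot R I)"
  using ideal.rcos_ring_hom[OF I] star_coset[OF I]
  by (auto simp: star_ring_hom_def ring_hom_def star_quot_def)

lemma carrier_star_quot: "carrier (star_quot R I) = (+>) I ` carrier R"
  by (auto simp: star_quot_def FactRing_def A_RCOSETS_def')

lemma coset_eq_iff: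
  assumes I: "ideal I R" and "a \<in> carrier R" "b \<in> carrier R"
  shows "I +> a = I +> b \<longleftrightarrow> a \<ominus> b \<in> I"
  using quotient_eq_iff_same_a_r_cos[OF assms] by simp

text \<open>
  Properness is the only axiom that does not descend at once: if \<open>a a\<^sup>* \<in> I\<close>, then
  \<open>a = a (a\<^sup>+ a)\<^sup>* = a a\<^sup>* (a\<^sup>+)\<^sup>*\<close> lies in \<open>I\<close>.
\<close>

lemma star_regular_ring_star_quot:
  assumes I: "ideal I R"
  shows "star_regular_ring (star_quot R I)" (is "star_regular_ring ?Q")
proof -
  interpret I: ideal I R by fact
  have h: "(+>) I \<in> ring_hom R ?Q" and hs: "\<And>a. a \<in> carrier R \<Longrightarrow> star ?Q (I +> a) = I +> star R a"
    using coset_hom[OF I] by (auto simp: star_ring_hom_def)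
  have z: "I +> \<zero> = \<zero>\<^bsub>?Q\<^esub>"
    using I.a_rcos_const by (simp add: star_quot_def FactRing_def)
  have "?Q \<lparr>carrier := (+>) I ` carrier R, zero := I +> \<zero>\<rparr> = ?Q"
    unfolding z carrier_star_quot[symmetric] by simp
  then interpret Q: ring ?Q
    using ring_hom_imp_img_ring[OF h] by simp
  note hm = ring_hom_mult[OF h, symmetric] ring_hom_add[OF h, symmetric]
  show ?thesis
  proof
    fix X assume "X \<in> carrier ?Q"
    then obtain a where a: "a \<in> carrier R" "X = I +> a" by (auto simp: carrier_star_quot)
    show "star ?Q X \<in> carrier ?Q" "star ?Q (star ?Q X) = X"
      using a by (auto simp: carrier_star_quot hs star_star)
    obtain x where "x \<in> carrier R" "a \<otimes> x \<otimes> a = a" using regular a by blast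
    then show "\<exists>Y\<in>carrier ?Q. X \<otimes>\<^bsub>?Q\<^esub> Y \<otimes>\<^bsub>?Q\<^esub> X = X"
      using a by (intro bexI[of _ "I +> x"]) (auto simp: carrier_star_quot hm)
    assume "X \<otimes>\<^bsub>?Q\<^esub> star ?Q X = \<zero>\<^bsub>?Q\<^esub>"
    then have "I +> a \<otimes> star R a = I +> \<zero>"
      using a z by (simp add: hs hm)
    then have "a \<otimes> star R a \<in> I"
      using a coset_eq_iff[OF I, of "a \<otimes> star R a" \<zero>] by (simp add: a_minus_def)
    then have mem: "a \<otimes> star R a \<otimes> star R (pinv R a) \<in> I"
      using I.I_r_closed a by simp
    have "a \<otimes> star R a \<otimes> star R (pinv R a) = a \<otimes> (star R a \<otimes> star R (pinv R a))"
      using a by (simp add: m_assoc)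
    also have "star R a \<otimes> star R (pinv R a) = pinv R a \<otimes> a"
      using a projectionsD(3)[OF pinv_mult(4)[OF a(1)]] by (simp add: star_mult)
    also have "a \<otimes> (pinv R a \<otimes> a) = a"
      using pinv_mult(1)[OF a(1)] a by (simp add: m_assoc)
    finally have "a \<in> I" using mem by simp
    then show "X = \<zero>\<^bsub>?Q\<^esub>"
      using a z coset_eq_iff[OF I a(1), of \<zero>] by (simp add: a_minus_def)
  next
    fix X Y assume "X \<in> carrier ?Q" "Y \<in> carrier ?Q"
    then obtain a b where "a \<in> carrier R" "X = I +> a" "b \<in> carrier R" "Y = I +> b"
      by (auto simp: carrier_star_quot)
    then show "star ?Q (X \<oplus>\<^bsub>?Q\<^esub> Y) = star ?Q X \<oplus>\<^bsub>?Q\<^esub> star ?Q Y"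
      "star ?Q (X \<otimes>\<^bsub>?Q\<^esub> Y) = star ?Q Y \<otimes>\<^bsub>?Q\<^esub> star ?Q X"
      by (simp_all add: hs hm star_add star_mult)
  qed
qed

end

section \<open>Equations under homomorphic images\<close>

lemma sr_eval_closed:
  assumes "star_regular_ring R" "range \<rho> \<subseteq> carrier R"
  shows "sr_eval R \<rho> t \<in> carrier R"
proof -
  interpret star_regular_ring R by fact
  show ?thesis using assms(2) by (induction t) auto
qed

text \<open>
  Homomorphisms preserve the equations that characterise a pseudo-inverse, and it is unique;
  so they preserve the operation of taking pseudo-inverses.
\<close>

lemma sr_eval_hom:
  assumes R: "star_regular_ring R" and S: "star_regular_ring S"
    and h: "h \<in> star_ring_hom R S" and \<rho>: "range \<rho> \<subseteq> carrier R"
  shows "sr_eval S (h \<circ> \<rho>) t = h (sr_eval R \<rho> t)"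
proof -
  interpret R: star_regular_ring R by fact
  interpret S: star_regular_ring S by fact
  have hr: "h \<in> ring_hom R S" and hs: "\<And>a. a \<in> carrier R \<Longrightarrow> h (star R a) = star S (h a)"
    using h by (auto simp: star_ring_hom_def)
  interpret ring_hom_ring R S h
    using R.ring_axioms S.ring_axioms hr by (rule ring_hom_ringI2)
  have pinv: "pinv S (h a) = h (pinv R a)" if a: "a \<in> carrier R" for a
  proof (rule S.pinv_eqI)
    have "is_pinv R a (pinv R a)" by (rule R.is_pinv_pinv[OF a])
    then show "is_pinv S (h a) (h (pinv R a))"
      using a unfolding is_pinv_def
      by (metis R.m_closed hom_closed hom_mult hs)
  qed (use a in simp)
  show ?thesis
    using sr_eval_closed[OF R \<rho>] by (induction t) (auto simp: hs pinv)
qed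

lemma models_hom_image:
  assumes R: "star_regular_ring R" and S: "star_regular_ring S"
    and h: "h \<in> star_ring_hom R S" and surj: "carrier S = h ` carrier R"
    and E: "models R E"
  shows "models S E"
  unfolding models_def
proof safe
  fix s t and \<sigma> :: "nat \<Rightarrow> _"
  assume st: "(s, t) \<in> E" and \<sigma>: "range \<sigma> \<subseteq> carrier S"
  then have "\<forall>i. \<exists>a. a \<in> carrier R \<and> h a = \<sigma> i"
    unfolding surj by (metis image_iff rangeI subsetD)
  then obtain \<rho> where \<rho>: "\<And>i. \<rho> i \<in> carrier R" "\<And>i. h (\<rho> i) = \<sigma> i" by metis
  then have "\<sigma> = h \<circ> \<rho>" "range \<rho> \<subseteq> carrier R" by auto
  moreover from this have "sr_eval R \<rho> s = sr_eval R \<rho> t"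
    using E st by (auto simp: models_def)
  ultimately show "sr_eval S \<sigma> s = sr_eval S \<sigma> t"
    using sr_eval_hom[OF R S h] by simp
qed

section \<open>Direct products\<close>

definition star_product :: "'k set \<Rightarrow> ('k \<Rightarrow> ('b, 'n) star_ring_scheme) \<Rightarrow> ('k \<Rightarrow> 'b) star_ring" where
  "star_product K S =
    \<lparr>carrier = (\<Pi>\<^sub>E k\<in>K. carrier (S k)), mult = (\<lambda>f g. \<lambda>k\<in>K. f k \<otimes>\<^bsub>S k\<^esub> g k),
     one = (\<lambda>k\<in>K. \<one>\<^bsub>S k\<^esub>), zero = (\<lambda>k\<in>K. \<zero>\<^bsub>S k\<^esub>),
     add = (\<lambda>f g. \<lambda>k\<in>K. f k \<oplus>\<^bsub>S k\<^esub> g k), star = (\<lambda>f. \<lambda>k\<in>K. star (S k) (f k))\<rparr>"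

lemma star_product_ops:
  "f \<otimes>\<^bsub>star_product K S\<^esub> g = (\<lambda>k\<in>K. f k \<otimes>\<^bsub>S k\<^esub> g k)"
  "f \<oplus>\<^bsub>star_product K S\<^esub> g = (\<lambda>k\<in>K. f k \<oplus>\<^bsub>S k\<^esub> g k)"
  "\<one>\<^bsub>star_product K S\<^esub> = (\<lambda>k\<in>K. \<one>\<^bsub>S k\<^esub>)"
  "\<zero>\<^bsub>star_product K S\<^esub> = (\<lambda>k\<in>K. \<zero>\<^bsub>S k\<^esub>)"
  "star (star_product K S) f = (\<lambda>k\<in>K. star (S k) (f k))"
  by (simp_all add: star_product_def)

lemma star_product_component_closed:
  "\<lbrakk>f \<in> carrier (star_product K S); k \<in> K\<rbrakk> \<Longrightarrow> f k \<in> carrier (S k)"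
  by (auto simp: star_product_def)

lemma restrict_in_star_product:
  "(\<And>k. k \<in> K \<Longrightarrow> f k \<in> carrier (S k)) \<Longrightarrow> restrict f K \<in> carrier (star_product K S)"
  by (simp add: star_product_def)

lemma restrict_eq_in_star_product:
  "\<lbrakk>f \<in> carrier (star_product K S); \<And>k. k \<in> K \<Longrightarrow> g k = f k\<rbrakk> \<Longrightarrow> restrict g K = f"
  by (auto simp: star_product_def PiE_def extensional_def fun_eq_iff restrict_def)

lemma star_product_eqI:
  "\<lbrakk>f \<in> carrier (star_product K S); g \<in> carrier (star_product K S); \<And>k. k \<in> K \<Longrightarrow> f k = g k\<rbrakk> \<Longrightarrow> f = g"
  by (auto simp: star_product_def intro: PiE_ext)

lemma ring_star_product:
  assumes "\<And>k. k \<in> K \<Longrightarrow> ring (S k)"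
  shows "ring (star_product K S)" (is "ring ?P")
proof (rule ringI)
  note a = abelian_groupE[OF ring.is_abelian_group[OF assms]]
  note m = ring.is_monoid[OF assms]
  note mem = star_product_component_closed
  show "abelian_group ?P"
  proof (rule abelian_groupI)
    fix f assume f: "f \<in> carrier ?P"
    then have "\<forall>k\<in>K. \<exists>g. g \<in> carrier (S k) \<and> g \<oplus>\<^bsub>S k\<^esub> f k = \<zero>\<^bsub>S k\<^esub>"
      using a(6)[OF _ mem[OF f]] by blast
    then obtain g where "\<forall>k\<in>K. g k \<in> carrier (S k) \<and> g k \<oplus>\<^bsub>S k\<^esub> f k = \<zero>\<^bsub>S k\<^esub>"
      by metis
    then show "\<exists>g\<in>carrier ?P. g \<oplus>\<^bsub>?P\<^esub> f = \<zero>\<^bsub>?P\<^esub>"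
      by (intro bexI[of _ "restrict g K"] restrict_in_star_product)
        (auto simp: star_product_ops intro!: restrict_ext)
    show "\<zero>\<^bsub>?P\<^esub> \<oplus>\<^bsub>?P\<^esub> f = f"
      unfolding star_product_ops
      by (rule restrict_eq_in_star_product[OF f]) (simp add: a(5) mem[OF f])
    fix g assume g: "g \<in> carrier ?P"
    show "f \<oplus>\<^bsub>?P\<^esub> g \<in> carrier ?P"
      unfolding star_product_ops by (rule restrict_in_star_product) (simp add: a(1) mem[OF f] mem[OF g])
    show "f \<oplus>\<^bsub>?P\<^esub> g = g \<oplus>\<^bsub>?P\<^esub> f"
      unfolding star_product_ops by (intro restrict_ext a(4) mem[OF f] mem[OF g])
    fix h assume h: "h \<in> carrier ?P"
    show "f \<oplus>\<^bsub>?P\<^esub> g \<oplus>\<^bsub>?P\<^esub> h = f \<oplus>\<^bsub>?P\<^esub> (g \<oplus>\<^bsub>?P\<^esub> h)"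
      unfolding star_product_ops by (rule restrict_ext) (simp add: a(3) mem[OF f] mem[OF g] mem[OF h])
  next
    show "\<zero>\<^bsub>?P\<^esub> \<in> carrier ?P"
      unfolding star_product_ops by (intro restrict_in_star_product a(2))
  qed
  show "monoid ?P"
  proof (rule monoidI)
    show "\<one>\<^bsub>?P\<^esub> \<in> carrier ?P"
      unfolding star_product_ops by (intro restrict_in_star_product monoid.one_closed[OF m])
    fix f assume f: "f \<in> carrier ?P"
    show "\<one>\<^bsub>?P\<^esub> \<otimes>\<^bsub>?P\<^esub> f = f" "f \<otimes>\<^bsub>?P\<^esub> \<one>\<^bsub>?P\<^esub> = f"
      unfolding star_product_ops
      by (rule restrict_eq_in_star_product[OF f];
          simp add: monoid.l_one[OF m] monoid.r_one[OF m] mem[OF f])+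
    fix g assume g: "g \<in> carrier ?P"
    show "f \<otimes>\<^bsub>?P\<^esub> g \<in> carrier ?P"
      unfolding star_product_ops
      by (rule restrict_in_star_product) (simp add: monoid.m_closed[OF m] mem[OF f] mem[OF g])
    fix h assume h: "h \<in> carrier ?P"
    show "f \<otimes>\<^bsub>?P\<^esub> g \<otimes>\<^bsub>?P\<^esub> h = f \<otimes>\<^bsub>?P\<^esub> (g \<otimes>\<^bsub>?P\<^esub> h)"
      unfolding star_product_ops
      by (rule restrict_ext) (simp add: monoid.m_assoc[OF m] mem[OF f] mem[OF g] mem[OF h])
  qed
  fix f g h assume f: "f \<in> carrier ?P" and g: "g \<in> carrier ?P" and h: "h \<in> carrier ?P"
  show "(f \<oplus>\<^bsub>?P\<^esub> g) \<otimes>\<^bsub>?P\<^esub> h = f \<otimes>\<^bsub>?P\<^esub> h \<oplus>\<^bsub>?P\<^esub> g \<otimes>\<^bsub>?P\<^esub> h"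
    "h \<otimes>\<^bsub>?P\<^esub> (f \<oplus>\<^bsub>?P\<^esub> g) = h \<otimes>\<^bsub>?P\<^esub> f \<oplus>\<^bsub>?P\<^esub> h \<otimes>\<^bsub>?P\<^esub> g"
    unfolding star_product_ops
    by (rule restrict_ext; simp add: ringE(3,4)[OF assms] mem[OF f] mem[OF g] mem[OF h])+
qed

lemma star_regular_ring_star_product:
  assumes S: "\<And>k. k \<in> K \<Longrightarrow> star_regular_ring (S k)"
  shows "star_regular_ring (star_product K S)" (is "star_regular_ring ?P")
proof -
  note st = star_regular_ring.axioms(1)[OF S]
  note mem = star_product_component_closed
  interpret ring ?P
    using st star_ring.axioms(1) by (blast intro: ring_star_product)
  show ?thesis
  proof
    fix f assume f: "f \<in> carrier ?P"
    show "star ?P f \<in> carrier ?P" "star ?P (star ?P f) = f"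
      using f by (auto simp: star_product_ops mem star_ring.star_closed[OF st]
          star_ring.star_star[OF st] intro!: restrict_in_star_product restrict_eq_in_star_product)
    have "\<forall>k\<in>K. \<exists>x. x \<in> carrier (S k) \<and> f k \<otimes>\<^bsub>S k\<^esub> x \<otimes>\<^bsub>S k\<^esub> f k = f k"
      using star_regular_ring.regular[OF S mem[OF f]] by metis
    then obtain x where x: "\<forall>k\<in>K. x k \<in> carrier (S k) \<and> f k \<otimes>\<^bsub>S k\<^esub> x k \<otimes>\<^bsub>S k\<^esub> f k = f k"
      by metis
    show "\<exists>x\<in>carrier ?P. f \<otimes>\<^bsub>?P\<^esub> x \<otimes>\<^bsub>?P\<^esub> f = f"
      using x f by (intro bexI[of _ "restrict x K"] restrict_in_star_product)
        (auto simp: star_product_ops intro!: restrict_eq_in_star_product)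
    assume 0: "f \<otimes>\<^bsub>?P\<^esub> star ?P f = \<zero>\<^bsub>?P\<^esub>"
    show "f = \<zero>\<^bsub>?P\<^esub>"
    proof (rule star_product_eqI[OF f zero_closed])
      fix k assume k: "k \<in> K"
      have "f k \<otimes>\<^bsub>S k\<^esub> star (S k) (f k) = \<zero>\<^bsub>S k\<^esub>"
        using fun_cong[OF 0, of k] k by (simp add: star_product_ops)
      then show "f k = \<zero>\<^bsub>?P\<^esub> k"
        using star_regular_ring.proper[OF S[OF k] mem[OF f k]] k by (simp add: star_product_ops)
    qed
  next
    fix f g assume "f \<in> carrier ?P" "g \<in> carrier ?P"
    then show "star ?P (f \<oplus>\<^bsub>?P\<^esub> g) = star ?P f \<oplus>\<^bsub>?P\<^esub> star ?P g"
      "star ?P (f \<otimes>\<^bsub>?P\<^esub> g) = star ?P g \<otimes>\<^bsub>?P\<^esub> star ?P f"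
      by (auto simp: star_product_ops mem star_ring.star_add[OF st] star_ring.star_mult[OF st]
          intro!: restrict_ext)
  qed
qed

lemma star_product_component_hom:
  "k \<in> K \<Longrightarrow> (\<lambda>f. f k) \<in> star_ring_hom (star_product K S) (S k)"
  by (auto simp: star_ring_hom_def ring_hom_def star_product_def)

lemma star_product_hom:
  assumes h: "\<And>k. k \<in> K \<Longrightarrow> h k \<in> star_ring_hom R (S k)"
  shows "(\<lambda>a. \<lambda>k\<in>K. h k a) \<in> star_ring_hom R (star_product K S)"
proof -
  have r: "h k \<in> ring_hom R (S k)" if "k \<in> K" for k
    using h[OF that] by (simp add: star_ring_hom_def)
  have s: "h k (star R a) = star (S k) (h k a)" if "k \<in> K" "a \<in> carrier R" for k a
    using h[OF that(1)] that(2) by (simp add: star_ring_hom_def)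
  have "(\<lambda>a. \<lambda>k\<in>K. h k a) \<in> ring_hom R (star_product K S)"
  proof (rule ring_hom_memI)
    fix a assume a: "a \<in> carrier R"
    show "(\<lambda>k\<in>K. h k a) \<in> carrier (star_product K S)"
      by (intro restrict_in_star_product ring_hom_closed[OF r a])
    fix b assume b: "b \<in> carrier R"
    show "(\<lambda>k\<in>K. h k (a \<otimes>\<^bsub>R\<^esub> b)) =
        (\<lambda>k\<in>K. h k a) \<otimes>\<^bsub>star_product K S\<^esub> (\<lambda>k\<in>K. h k b)"
      unfolding star_product_ops by (rule restrict_ext) (simp add: ring_hom_mult[OF r a b])
    show "(\<lambda>k\<in>K. h k (a \<oplus>\<^bsub>R\<^esub> b)) =
        (\<lambda>k\<in>K. h k a) \<oplus>\<^bsub>star_product K S\<^esub> (\<lambda>k\<in>K. h k b)"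
      unfolding star_product_ops by (rule restrict_ext) (simp add: ring_hom_add[OF r a b])
  next
    show "(\<lambda>k\<in>K. h k \<one>\<^bsub>R\<^esub>) = \<one>\<^bsub>star_product K S\<^esub>"
      unfolding star_product_ops by (intro restrict_ext ring_hom_one r)
  qed
  moreover have "(\<lambda>k\<in>K. h k (star R a)) = star (star_product K S) (\<lambda>k\<in>K. h k a)"
    if a: "a \<in> carrier R" for a
    unfolding star_product_ops by (rule restrict_ext) (simp add: s a)
  ultimately show ?thesis by (simp add: star_ring_hom_def)
qed

lemma models_star_product:
  assumes S: "\<And>k. k \<in> K \<Longrightarrow> star_regular_ring (S k)"
    and E: "\<And>k. k \<in> K \<Longrightarrow> models (S k) E"
  shows "models (star_product K S) E" (is "models ?P E")
  unfolding models_def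
proof safe
  note P = star_regular_ring_star_product[OF S, of K]
  fix s t and \<rho> :: "nat \<Rightarrow> _" assume st: "(s, t) \<in> E" and \<rho>: "range \<rho> \<subseteq> carrier ?P"
  show "sr_eval ?P \<rho> s = sr_eval ?P \<rho> t"
  proof (rule star_product_eqI[OF sr_eval_closed[OF P \<rho>] sr_eval_closed[OF P \<rho>]])
    fix k assume k: "k \<in> K"
    let ?h = "\<lambda>f. f k"
    have "range (?h \<circ> \<rho>) \<subseteq> carrier (S k)"
      using \<rho> k by (auto simp: star_product_def)
    then have "sr_eval (S k) (?h \<circ> \<rho>) s = sr_eval (S k) (?h \<circ> \<rho>) t"
      using E[OF k] st by (auto simp: models_def)
    then show "sr_eval ?P \<rho> s k = sr_eval ?P \<rho> t k"
      using sr_eval_hom[OF P S[OF k] star_product_component_hom[OF k] \<rho>, of s]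
        sr_eval_hom[OF P S[OF k] star_product_component_hom[OF k] \<rho>, of t] by metis
  qed
qed

lemma star_product_UnitsI:
  assumes u: "\<And>k. k \<in> K \<Longrightarrow> u k \<in> Units (S k)"
  shows "restrict u K \<in> Units (star_product K S)"
proof -
  have "\<forall>k\<in>K. \<exists>v. v \<in> carrier (S k) \<and> v \<otimes>\<^bsub>S k\<^esub> u k = \<one>\<^bsub>S k\<^esub> \<and> u k \<otimes>\<^bsub>S k\<^esub> v = \<one>\<^bsub>S k\<^esub>"
    using u unfolding Units_def by blast
  then obtain v where "\<forall>k\<in>K. v k \<in> carrier (S k) \<and> v k \<otimes>\<^bsub>S k\<^esub> u k = \<one>\<^bsub>S k\<^esub> \<and> u k \<otimes>\<^bsub>S k\<^esub> v k = \<one>\<^bsub>S k\<^esub>"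
    by metis
  moreover have "\<forall>k\<in>K. u k \<in> carrier (S k)" using u unfolding Units_def by blast
  ultimately show ?thesis
    unfolding Units_def
    by (auto simp: star_product_def intro!: bexI[of _ "restrict v K"] restrict_ext)
qed

lemma unit_regular_star_product:
  assumes "\<And>k. k \<in> K \<Longrightarrow> unit_regular (S k)"
  shows "unit_regular (star_product K S)"
  unfolding unit_regular_def
proof
  fix f assume f: "f \<in> carrier (star_product K S)"
  have "\<exists>u. u \<in> Units (S k) \<and> f k \<otimes>\<^bsub>S k\<^esub> u \<otimes>\<^bsub>S k\<^esub> f k = f k" if k: "k \<in> K" for k
    using assms[OF k] star_product_component_closed[OF f k] by (auto simp: unit_regular_def)
  then obtain u where u: "\<forall>k\<in>K. u k \<in> Units (S k) \<and> f k \<otimes>\<^bsub>S k\<^esub> u k \<otimes>\<^bsub>S k\<^esub> f k = f k"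
    by metis
  have "f \<otimes>\<^bsub>star_product K S\<^esub> restrict u K \<otimes>\<^bsub>star_product K S\<^esub> f = f"
    using u f by (auto simp: star_product_def intro!: PiE_ext)
  then show "\<exists>u\<in>Units (star_product K S). f \<otimes>\<^bsub>star_product K S\<^esub> u \<otimes>\<^bsub>star_product K S\<^esub> f = f"
    using u star_product_UnitsI[of K u S] by (intro bexI[of _ "restrict u K"]) simp_all
qed

lemma star_clean_star_product:
  assumes "\<And>k. k \<in> K \<Longrightarrow> star_clean (S k)"
  shows "star_clean (star_product K S)"
  unfolding star_clean_def
proof
  fix f assume f: "f \<in> carrier (star_product K S)"
  have "\<exists>u e. u \<in> Units (S k) \<and> e \<in> projections (S k) \<and> f k = u \<oplus>\<^bsub>S k\<^esub> e" if k: "k \<in> K" for k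
    using assms[OF k] star_product_component_closed[OF f k] unfolding star_clean_def by blast
  then obtain u e where ue: "\<forall>k\<in>K. u k \<in> Units (S k) \<and> e k \<in> projections (S k) \<and> f k = u k \<oplus>\<^bsub>S k\<^esub> e k"
    by metis
  have "restrict e K \<in> projections (star_product K S)"
    using ue by (auto simp: projections_def star_product_def intro!: restrict_ext)
  moreover have "f = restrict u K \<oplus>\<^bsub>star_product K S\<^esub> restrict e K"
    using ue f by (auto simp: star_product_def fun_eq_iff restrict_def PiE_def extensional_def)
  ultimately show "\<exists>u\<in>Units (star_product K S). \<exists>e\<in>projections (star_product K S). f = u \<oplus>\<^bsub>star_product K S\<^esub> e"
    using ue star_product_UnitsI[of K u S]
    by (intro bexI[of _ "restrict u K"] bexI[of _ "restrict e K"]) simp_all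
qed

section \<open>The unit-regular and star-clean extension\<close>

theorem theorem5:
  fixes R :: "('a, 'm) star_ring_scheme"
    and K :: "'k set"
    and I :: "'k \<Rightarrow> 'a set"
  assumes "subdirect_product_of_artinian R K I"
  shows "\<exists>(Rhat :: ('k \<Rightarrow> 'a set) star_ring) \<phi>.
    star_regular_ring Rhat \<and>
    in_variety_generated_by Rhat R \<and>
    \<phi> \<in> star_ring_hom R Rhat \<and> inj_on \<phi> (carrier R) \<and>
    unit_regular Rhat \<and>
    star_clean Rhat"
proof -
  have R: "star_regular_ring R" and I: "\<And>k. k \<in> K \<Longrightarrow> ideal (I k) R"
    and cap: "carrier R \<inter> (\<Inter>k\<in>K. I k) = {\<zero>\<^bsub>R\<^esub>}"
    and art: "\<And>k. k \<in> K \<Longrightarrow> artinian (star_quot R (I k))"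
    using assms by (auto simp: subdirect_product_of_artinian_def)
  interpret star_regular_ring R by (rule R)
  define Q where "Q = (\<lambda>k. star_quot R (I k))"
  define \<phi> where "\<phi> = (\<lambda>a. \<lambda>k\<in>K. I k +>\<^bsub>R\<^esub> a)"
  have Q: "star_regular_ring (Q k)" if "k \<in> K" for k
    using star_regular_ring_star_quot I that by (simp add: Q_def)
  note hom = coset_hom[OF I, folded Q_def[THEN fun_cong]]
  have P: "star_regular_ring (star_product K Q)"
    by (rule star_regular_ring_star_product[OF Q])
  have "in_variety (star_product K Q) E" if E: "in_variety R E" for E
  proof -
    have "models (Q k) E" if k: "k \<in> K" for k
      using models_hom_image[OF R Q[OF k] hom[OF k]] carrier_star_quot E
      by (simp add: Q_def in_variety_def)
    then show ?thesis
      using models_star_product[of K Q E] Q P by (simp add: in_variety_def)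
  qed
  moreover have "\<phi> \<in> star_ring_hom R (star_product K Q)"
    unfolding \<phi>_def by (intro star_product_hom hom)
  moreover have "inj_on \<phi> (carrier R)"
  proof (rule inj_onI)
    fix a b assume a: "a \<in> carrier R" and b: "b \<in> carrier R" and eq: "\<phi> a = \<phi> b"
    have "a \<ominus>\<^bsub>R\<^esub> b \<in> I k" if k: "k \<in> K" for k
      using fun_cong[OF eq, of k] k coset_eq_iff[OF I[OF k] a b] by (simp add: \<phi>_def)
    then have "a \<ominus>\<^bsub>R\<^esub> b \<in> carrier R \<inter> (\<Inter>k\<in>K. I k)" using a b by simp
    then show "a = b" unfolding cap using minus_eq_zero_iff a b by simp
  qed
  moreover have "unit_regular (star_product K Q)" "star_clean (star_product K Q)"
    using unit_regular_star_product star_clean_star_product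
      star_regular_ring.artinian_unit_regular[OF Q] star_regular_ring.artinian_star_clean[OF Q] art
    by (metis Q_def)+
  ultimately show ?thesis
    using P unfolding in_variety_generated_by_def by blast
qed

end
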